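(* Let $r,a,b$ be integers with $1\le b<r$, $a\ge1$ and $a+b\le r$, and let $L\subseteq[0,b]$. Put $$J_{r,b}(L)\coloneqq\{j\in[0,b-1]\setminus L:\ 2b-j\le r\},\qquad \mathcal T^r_{a,b,L}\coloneqq\{T^r_{a,b,b,j}: j\in J_{r,b}(L)\}.$$ Then $$\pi(\mathcal T^r_{a,b,L})\le\frac{\Psi(r,b,L)}{\binom rb}.$$
   Context: Integer intervals: $[q]=\{1,\dots,q\}$ and $[p,q]=\{p,p+1,\dots,q\}$, with $[p,q]=\emptyset$ if $p>q$. For $r\ge2$, an $r$-graph is a family of $r$-subsets (edges) of a vertex set; $|H|$ is the number of edges of $H$. For a family $\mathcal F$ of $r$-graphs, $H$ is $\mathcal F$-free if it contains no member of $\mathcal F$ as a (not necessarily induced) subgraph; $\mathrm{ex}(n,\mathcal F)=\max\{|H|: |V(H)|=n,\ H\text{ is }\mathcal F\text{-free}\}$, and the Turán density is $\pi(\mathcal F)=\lim_{n\to\infty}\mathrm{ex}(n,\mathcal F)/\binom nr$. A partial hypergraph is a finite vertex set together with a finite collection $e_1,\dots,e_t$ of subsets of it (partial edges, not necessarily of the same size). If all $|e_j|\le r$, its $r$-uniform extension is the $r$-graph obtained by adding, for each $j\in[t]$, a private set $U_j$ of $r-|e_j|$ new vertices (the $U_j$ pairwise disjoint) and taking as edges the sets $e_j\cup U_j$, $j\in[t]$. Definition of $T^r_{a,b,c,d}$ (used here with $c=b$, $d=j$): choose disjoint sets $A,E$ with $|A|=a$, $|E|=r$, and $B,C\subseteq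 E$ with $|B|=b$, $|C|=c$, $|B\cap C|=d$. Then $T^r_{a,b,c,d}$ is the $r$-uniform extension of the partial hypergraph on $A\cup E$ with partial edges $E$, $A\cup B$, $A\cup C$. For $L\subseteq[0,b]$, a family $\mathcal B\subseteq\binom{[r]}{b}$ is $L$-intersecting if $|B\cap B'|\in L$ for all distinct $B,B'\in\mathcal B$, and $\Psi(r,b,L)$ is the maximum of $|\mathcal B|$ over $L$-intersecting $\mathcal B\subseteq\binom{[r]}{b}$. *)

theory Defs
  imports Complex_Main "HOL-Library.Ramsey"
begin

text \<open>A hypergraph is a pair of a vertex set and an edge set.\<close>

type_synonym 'v hypergraph = "'v set \<times> 'v set set"

abbreviation verts :: "'v hypergraph \<Rightarrow> 'v set" where
  "verts H \<equiv> fst H"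

abbreviation edges :: "'v hypergraph \<Rightarrow> 'v set set" where
  "edges H \<equiv> snd H"

definition r_graph :: "nat \<Rightarrow> 'v hypergraph \<Rightarrow> bool" where
  "r_graph r H \<longleftrightarrow> finite (verts H) \<and> edges H \<subseteq> nsets (verts H) r"

text \<open>Containment as a not necessarily induced subgraph, up to isomorphism.\<close>

definition contains_copy :: "'w hypergraph \<Rightarrow> 'v hypergraph \<Rightarrow> bool" where
  "contains_copy H F \<longleftrightarrow>
     (\<exists>f. inj_on f (verts F) \<and> f ` verts F \<subseteq> verts H \<and> (\<forall>e\<in>edges F. f ` e \<in> edges H))"

definition family_free :: "'v hypergraph set \<Rightarrow> 'w hypergraph \<Rightarrow> bool" where
  "family_free \<F> H \<longleftrightarrow> (\<forall>F\<in>\<F>. \<not> contains_copy H F)"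

text \<open>Since only finite host hypergraphs matter, their vertices are taken to be natural
  numbers; every finite hypergraph has an isomorphic copy of this kind.\<close>

definition ex_number :: "nat \<Rightarrow> nat \<Rightarrow> 'v hypergraph set \<Rightarrow> nat" where
  "ex_number r n \<F> =
     Max {card (edges H) | H :: nat hypergraph.
            r_graph r H \<and> card (verts H) = n \<and> family_free \<F> H}"

definition turan_density :: "nat \<Rightarrow> 'v hypergraph set \<Rightarrow> real" where
  "turan_density r \<F> = lim (\<lambda>n. real (ex_number r n \<F>) / real (n choose r))"

text \<open>The partial edges are given as a list \<open>es\<close>. The old vertices are tagged with \<open>Inl\<close>;
  the private set of the partial edge \<open>es ! j\<close> consists of the new vertices \<open>Inr (j, i)\<close> with
  \<open>i < r - card (es ! j)\<close>.\<close>

definition private_set :: "nat \<Rightarrow> 'v set list \<Rightarrow> nat \<Rightarrow> ('v + nat \<times> nat) set" where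
  "private_set r es j = Inr ` ({j} \<times> {..<r - card (es ! j)})"

definition uniform_extension ::
  "nat \<Rightarrow> 'v set \<Rightarrow> 'v set list \<Rightarrow> ('v + nat \<times> nat) hypergraph" where
  "uniform_extension r V es =
     (Inl ` V \<union> (\<Union>j<length es. private_set r es j),
      {Inl ` (es ! j) \<union> private_set r es j | j. j < length es})"

text \<open>The hypergraph \<open>T\<^sup>r\<^sub>a\<^sub>,\<^sub>b\<^sub>,\<^sub>c\<^sub>,\<^sub>d\<close> is determined only up to isomorphism, by a choice of
  \<open>A, E, B, C\<close>. It is represented here by the set of all hypergraphs arising from such choices
  of sets of natural numbers; these are pairwise isomorphic.\<close>

definition T_graphs ::
  "nat \<Rightarrow> nat \<Rightarrow> nat \<Rightarrow> nat \<Rightarrow> nat \<Rightarrow> (nat + nat \<times> nat) hypergraph set" where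
  "T_graphs r a b c d =
     {uniform_extension r (A \<union> E) [E, A \<union> B, A \<union> C] | A E B C.
        finite A \<and> finite E \<and> A \<inter> E = {} \<and> card A = a \<and> card E = r \<and>
        B \<subseteq> E \<and> C \<subseteq> E \<and> card B = b \<and> card C = c \<and> card (B \<inter> C) = d}"

definition J_set :: "nat \<Rightarrow> nat \<Rightarrow> nat set \<Rightarrow> nat set" where
  "J_set r b L = {j \<in> {0..<b} - L. 2 * b - j \<le> r}"

definition T_family ::
  "nat \<Rightarrow> nat \<Rightarrow> nat \<Rightarrow> nat set \<Rightarrow> (nat + nat \<times> nat) hypergraph set" where
  "T_family r a b L = (\<Union>j\<in>J_set r b L. T_graphs r a b b j)"

definition L_intersecting :: "nat set \<Rightarrow> 'v set set \<Rightarrow> bool" where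
  "L_intersecting L \<B> \<longleftrightarrow> (\<forall>B\<in>\<B>. \<forall>B'\<in>\<B>. B \<noteq> B' \<longrightarrow> card (B \<inter> B') \<in> L)"

definition Psi :: "nat \<Rightarrow> nat \<Rightarrow> nat set \<Rightarrow> nat" where
  "Psi r b L = Max {card \<B> | \<B>. \<B> \<subseteq> nsets {1..r} b \<and> L_intersecting L \<B>}"

end

theory Submission
  imports Defs "HOL-Analysis.Convex" "HOL-Real_Asymp.Real_Asymp"
begin

text \<open>
  Let \<open>H\<close> be a free hypergraph on \<open>n\<close> vertices. Call a set of \<open>a + b\<close> vertices heavy if it extends
  to an edge avoiding any bounded set of forbidden vertices; a set that is not heavy lies in
  \<open>O(n\<^sup>r\<^sup>-\<^sup>a\<^sup>-\<^sup>b\<^sup>-\<^sup>1)\<close> edges. For an edge \<open>E\<close> and an \<open>a\<close>-set \<open>A\<close> disjoint from it, the \<open>b\<close>-sets \<open>B \<subseteq> E\<close>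
  with \<open>A \<union> B\<close> heavy are \<open>L\<close>-intersecting: otherwise two of them, extended to edges one after the
  other, give a forbidden configuration. So there are at most \<open>\<Psi>(r, b, L)\<close> of them. Summing over
  \<open>A\<close> and \<open>E\<close>, and counting the same triples \<open>(A, B, E)\<close> through \<open>B\<close>, bounds the sum of the squared
  degrees of the \<open>b\<close>-sets, and Cauchy--Schwarz turns this into the bound on \<open>|H|\<close>.
\<close>

section \<open>Degrees of vertex sets and double counting\<close>

lemma nsetsD: "e \<in> nsets V k \<Longrightarrow> e \<subseteq> V \<and> finite e \<and> card e = k"
  by (simp add: nsets_def)

lemma finite_edges: "finite V \<Longrightarrow> H \<subseteq> nsets V r \<Longrightarrow> finite H"
  using finite_imp_finite_nsets finite_subset by blast

definition degree :: "'v set set \<Rightarrow> 'v set \<Rightarrow> nat" where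
  "degree H S = card {e\<in>H. S \<subseteq> e}"

lemma card_incidences:
  assumes "finite X" "finite Y"
  shows "(\<Sum>x\<in>X. card {y\<in>Y. P x y}) = (\<Sum>y\<in>Y. card {x\<in>X. P x y})"
proof -
  have "(\<Sum>x\<in>X. card {y\<in>Y. P x y}) = (\<Sum>x\<in>X. \<Sum>y\<in>Y. if P x y then 1 else 0)"
    using assms by (simp add: sum.If_cases Int_def)
  also have "\<dots> = (\<Sum>y\<in>Y. \<Sum>x\<in>X. if P x y then 1 else 0)"
    by (rule sum.swap)
  also have "\<dots> = (\<Sum>y\<in>Y. card {x\<in>X. P x y})"
    using assms by (simp add: sum.If_cases Int_def)
  finally show ?thesis .
qed

lemma sum_degree:
  assumes "finite V" "H \<subseteq> nsets V r"
  shows "(\<Sum>B\<in>nsets V b. degree H B) = card H * (r choose b)"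
proof -
  have "(\<Sum>B\<in>nsets V b. degree H B) = (\<Sum>e\<in>H. card {B\<in>nsets V b. B \<subseteq> e})"
    unfolding degree_def using assms
    by (intro card_incidences finite_imp_finite_nsets finite_edges)
  also have "\<dots> = (\<Sum>e\<in>H. r choose b)"
  proof (rule sum.cong[OF refl])
    fix e assume "e \<in> H"
    then have e: "e \<subseteq> V" "finite e" "card e = r" using assms nsetsD by blast+
    then have "{B\<in>nsets V b. B \<subseteq> e} = nsets e b" by (auto simp: nsets_def)
    with e show "card {B\<in>nsets V b. B \<subseteq> e} = r choose b" by (simp add: card_nsets)
  qed
  finally show ?thesis by simp
qed

text \<open>An edge \<open>e\<close> is counted only if it contains \<open>B\<close>, and then once
  for every \<open>a\<close>-subset \<open>A\<close> of the \<open>r - b\<close> vertices of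
  \<open>e - B\<close>.\<close>

lemma sum_degree_Un:
  assumes "finite V" "H \<subseteq> nsets V r" "B \<in> nsets V b"
  shows "(\<Sum>A\<in>nsets (V - B) a. degree H (A \<union> B)) = degree H B * (r - b choose a)"
proof -
  have fH: "finite H" using assms finite_edges by blast
  have "(\<Sum>A\<in>nsets (V - B) a. degree H (A \<union> B))
      = (\<Sum>e\<in>H. card {A\<in>nsets (V - B) a. A \<union> B \<subseteq> e})"
    unfolding degree_def using assms fH
    by (intro card_incidences finite_imp_finite_nsets) auto
  also have "\<dots> = (\<Sum>e\<in>H. if B \<subseteq> e then r - b choose a else 0)"
  proof (rule sum.cong[OF refl])
    fix e assume "e \<in> H"
    then have e: "e \<subseteq> V" "finite e" "card e = r" using assms nsetsD by blast+
    show "card {A\<in>nsets (V - B) a. A \<union> B \<subseteq> e} = (if B \<subseteq> e then r - b choose a else 0)"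
    proof (cases "B \<subseteq> e")
      case True
      then have "{A\<in>nsets (V - B) a. A \<union> B \<subseteq> e} = nsets (e - B) a"
        using e by (auto simp: nsets_def)
      moreover have "card (e - B) = r - b"
        using True e nsetsD[OF assms(3)] by (simp add: card_Diff_subset)
      ultimately show ?thesis using e True by (simp add: card_nsets)
    next
      case False
      then have "{A\<in>nsets (V - B) a. A \<union> B \<subseteq> e} = {}" by auto
      then show ?thesis using False by simp
    qed
  qed
  also have "\<dots> = degree H B * (r - b choose a)"
    using fH by (simp add: degree_def sum.If_cases Int_def)
  finally show ?thesis .
qed

text \<open>Deleting \<open>S\<close> is injective on the edges containing \<open>S\<close> and
  leaves \<open>r - card S\<close> vertices.\<close>

lemma degree_le:
  assumes "finite V" "H \<subseteq> nsets V r" "finite S"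
  shows "degree H S \<le> card V choose (r - card S)"
proof -
  have "card {e\<in>H. S \<subseteq> e} \<le> card (nsets V (r - card S))"
  proof (rule card_inj_on_le)
    show "inj_on (\<lambda>e. e - S) {e\<in>H. S \<subseteq> e}" by (auto simp: inj_on_def)
    show "(\<lambda>e. e - S) ` {e\<in>H. S \<subseteq> e} \<subseteq> nsets V (r - card S)"
      using assms by (auto simp: nsets_def card_Diff_subset)
  qed (use assms in \<open>simp add: finite_imp_finite_nsets\<close>)
  then show ?thesis using assms by (simp add: degree_def card_nsets)
qed

lemma fact_mult_binomial_le_pow: "fact k * (n choose k) \<le> (n::nat) ^ k"
  using binomial_fact_pow[of n k] by (simp add: mult.commute)

lemma binomial_le_power: "(n choose k) \<le> (n::nat) ^ k"
proof -
  have "1 * (n choose k) \<le> fact k * (n choose k)" by (rule mult_right_mono) auto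
  then show ?thesis using le_trans[OF _ fact_mult_binomial_le_pow[of k n]] by simp
qed

section \<open>Heavy sets\<close>

text \<open>Robust extendability, rather than a lower bound on the degree, is what a greedy choice
  of edges uses: \<open>X\<close> collects the vertices already occupied. In an
  \<open>r\<close>-graph, a finite set of \<open>r\<close> vertices is heavy exactly when it is an
  edge.\<close>

definition heavy :: "nat \<Rightarrow> 'v set set \<Rightarrow> 'v set \<Rightarrow> bool" where
  "heavy q H S \<longleftrightarrow> (\<forall>X. finite X \<and> card X \<le> q \<longrightarrow> (\<exists>e\<in>H. S \<subseteq> e \<and> (e - S) \<inter> X = {}))"

text \<open>Multiplying by \<open>card V\<close> covers the case \<open>card S = r\<close>, where a set that is
  not heavy has degree zero.\<close>

lemma degree_not_heavy:
  assumes "finite V" "H \<subseteq> nsets V r" "S \<subseteq> V" "card S \<le> r" "\<not> heavy q H S"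
  shows "card V * degree H S \<le> q * card V ^ (r - card S)"
proof -
  obtain X where X: "finite X" "card X \<le> q" "\<And>e. e \<in> H \<Longrightarrow> S \<subseteq> e \<Longrightarrow> (e - S) \<inter> X \<noteq> {}"
    using assms(5) by (auto simp: heavy_def)
  have fS: "finite S" and fH: "finite H" using assms finite_subset finite_edges by blast+
  show ?thesis
  proof (cases "card S = r")
    case True
    have "degree H S = 0"
    proof (rule ccontr)
      assume "degree H S \<noteq> 0"
      then obtain e where e: "e \<in> H" "S \<subseteq> e"
        unfolding degree_def by (metis (mono_tags, lifting) card.empty empty_Collect_eq)
      then have "finite e" "card e = r" using assms(2) nsetsD by blast+
      then have "S = e" using e True by (simp add: card_subset_eq)
      then show False using X(3)[OF e] by simp
    qed
    then show ?thesis by simp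
  next
    case False
    then obtain k where k: "r - card S = Suc k" using assms(4)
      by (metis diff_is_0_eq le_antisym not0_implies_Suc)
    \<comment> \<open>The blocking set \<open>X\<close> meets \<open>e - S\<close> for every edge
      \<open>e\<close> containing \<open>S\<close>, so \<open>e\<close> contains one of at most
      \<open>q\<close> sets \<open>insert x S\<close>, which leaves one free vertex fewer.\<close>
    have "{e\<in>H. S \<subseteq> e} \<subseteq> (\<Union>x\<in>X - S. {e\<in>H. insert x S \<subseteq> e})" using X(3) by auto
    then have "degree H S \<le> card (\<Union>x\<in>X - S. {e\<in>H. insert x S \<subseteq> e})"
      unfolding degree_def using X(1) fH by (intro card_mono) auto
    also have "\<dots> \<le> (\<Sum>x\<in>X - S. degree H (insert x S))"
      unfolding degree_def using X(1) by (intro card_UN_le) auto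
    also have "\<dots> \<le> (\<Sum>x\<in>X - S. card V ^ k)"
    proof (rule sum_mono)
      fix x assume "x \<in> X - S"
      then have "r - card (insert x S) = k" using fS k by simp
      then have "degree H (insert x S) \<le> card V choose k"
        using degree_le[OF assms(1,2), of "insert x S"] fS by simp
      then show "degree H (insert x S) \<le> card V ^ k" using binomial_le_power le_trans by blast
    qed
    also have "\<dots> \<le> q * card V ^ k"
      using X(1,2) card_mono[of X "X - S"] by simp
    finally have "card V * degree H S \<le> card V * (q * card V ^ k)" by (rule mult_left_mono) simp
    then show ?thesis by (simp add: k mult_ac)
  qed
qed

text \<open>Fixing a vertex of \<open>E\<close> in \<open>A\<close> leaves \<open>a\<close> vertices
  to choose. The order of this bound in \<open>card V\<close> is one below that of the number of all
  \<open>Suc a\<close>-sets, so the sets meeting a given edge are negligible.\<close>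

lemma card_nsets_meeting_le:
  assumes "finite V" "finite E"
  shows "card {A\<in>nsets V (Suc a). A \<inter> E \<noteq> {}} \<le> card E * card V ^ a"
proof -
  have "{A\<in>nsets V (Suc a). A \<inter> E \<noteq> {}} \<subseteq> (\<Union>x\<in>E. {A\<in>nsets V (Suc a). {x} \<subseteq> A})" by auto
  then have "card {A\<in>nsets V (Suc a). A \<inter> E \<noteq> {}}
      \<le> card (\<Union>x\<in>E. {A\<in>nsets V (Suc a). {x} \<subseteq> A})"
    using assms by (intro card_mono) (auto simp: finite_imp_finite_nsets)
  also have "\<dots> \<le> (\<Sum>x\<in>E. degree (nsets V (Suc a)) {x})"
    unfolding degree_def using assms by (intro card_UN_le) auto
  also have "\<dots> \<le> (\<Sum>x\<in>E. card V ^ a)"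
    using degree_le[OF assms(1) order_refl] binomial_le_power
    by (intro sum_mono) (metis card.empty card_insert_disjoint diff_Suc_1 empty_iff finite.emptyI
      finite.insertI le_trans One_nat_def)
  finally show ?thesis by simp
qed

section \<open>Intersecting families and forbidden configurations\<close>

text \<open>\<open>Psi\<close> refers to the ground set \<open>{1..r}\<close>. A bijection from
  \<open>E\<close> carries the family there and preserves the sizes of its members and of their
  intersections.\<close>

lemma card_L_intersecting_le_Psi:
  assumes "finite E" "card E = r" "\<B> \<subseteq> nsets E b" "L_intersecting L \<B>"
  shows "card \<B> \<le> Psi r b L"
proof -
  obtain f where f: "bij_betw f E {1..r}"
    using assms(1,2) by (metis card_atLeastAtMost diff_Suc_1 finite_atLeastAtMost finite_same_card_bij)
  have inj: "inj_on f E" using f bij_betw_def by blast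
  have sub: "B \<subseteq> E" if "B \<in> \<B>" for B using that assms(3) nsetsD by blast
  have injB: "inj_on ((`) f) \<B>"
    using inj sub by (intro inj_onI) (meson inj_on_image_eq_iff)
  have "(`) f ` \<B> \<subseteq> nsets {1..r} b"
    using bij_betw_nsets[OF f, of b] assms(3) unfolding bij_betw_def by blast
  moreover have "L_intersecting L ((`) f ` \<B>)"
    unfolding L_intersecting_def
  proof (intro ballI impI)
    fix P Q assume "P \<in> (`) f ` \<B>" "Q \<in> (`) f ` \<B>" "P \<noteq> Q"
    then obtain B C where BC: "B \<in> \<B>" "C \<in> \<B>" "B \<noteq> C" "P = f ` B" "Q = f ` C" by blast
    have "P \<inter> Q = f ` (B \<inter> C)" using BC inj_on_image_Int[OF inj] sub by simp
    moreover have "inj_on f (B \<inter> C)" using inj sub BC by (meson inf.coboundedI1 inj_on_subset)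
    ultimately show "card (P \<inter> Q) \<in> L"
      using BC assms(4) unfolding L_intersecting_def by (simp add: card_image)
  qed
  moreover have "finite {card \<B> | \<B>. \<B> \<subseteq> nsets {1..r} b \<and> L_intersecting L \<B>}"
    by (rule finite_subset[of _ "card ` Pow (nsets {1..r} b)"])
      (auto simp: finite_imp_finite_nsets)
  ultimately have "card ((`) f ` \<B>) \<le> Psi r b L"
    unfolding Psi_def by (intro Max_ge) auto
  then show ?thesis using injB by (simp add: card_image)
qed

text \<open>Greedy embedding: \<open>A \<union> B\<close> extends to an edge \<open>e1\<close> whose
  new vertices avoid \<open>A \<union> E\<close>, then \<open>A \<union> C\<close> extends to an
  edge \<open>e2\<close> whose new vertices avoid \<open>e1\<close> as well. The sets to be avoided
  have at most \<open>2 * r\<close> and \<open>3 * r\<close> vertices, whence the threshold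
  \<open>3 * r\<close>.\<close>

lemma contains_uniform_extension:
  fixes H :: "nat hypergraph"
  assumes rH: "r_graph r H"
    and A: "finite A" "A \<subseteq> verts H" and E: "E \<in> edges H" and disj: "A \<inter> E = {}"
    and B: "B \<subseteq> E" and C: "C \<subseteq> E" and BC: "card B = card C"
    and hB: "heavy (3 * r) (edges H) (A \<union> B)" and hC: "heavy (3 * r) (edges H) (A \<union> C)"
    and ar: "card A \<le> r"
  shows "contains_copy H (uniform_extension r (A \<union> E) [E, A \<union> B, A \<union> C])"
proof -
  have edge: "e \<subseteq> verts H \<and> finite e \<and> card e = r" if "e \<in> edges H" for e
    using rH that nsetsD unfolding r_graph_def by blast
  have fE: "finite E" "card E = r" "E \<subseteq> verts H" using edge E by auto
  have fB: "finite B" "finite C" using B C fE finite_subset by auto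
  have cAE: "card (A \<union> E) \<le> 2 * r" using card_Un_le[of A E] fE ar by simp
  obtain e1 where e1: "e1 \<in> edges H" "A \<union> B \<subseteq> e1" "(e1 - (A \<union> B)) \<inter> (A \<union> E) = {}"
    using hB[unfolded heavy_def, rule_format, of "A \<union> E"] cAE A fE by auto
  have "card (A \<union> E \<union> e1) \<le> 3 * r"
    using card_Un_le[of "A \<union> E" e1] cAE edge[OF e1(1)] by simp
  then obtain e2 where e2: "e2 \<in> edges H" "A \<union> C \<subseteq> e2" "(e2 - (A \<union> C)) \<inter> (A \<union> E \<union> e1) = {}"
    using hC[unfolded heavy_def, rule_format, of "A \<union> E \<union> e1"] A fE edge[OF e1(1)] by auto
  \<comment> \<open>Indices 1 and 2 are the list positions of \<open>A \<union> B\<close> and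
    \<open>A \<union> C\<close>. The default branch makes every \<open>U i\<close> a set of
    \<open>k\<close> vertices, so that one family \<open>g\<close> of bijections can be chosen for
    all \<open>i\<close>.\<close>
  define U where "U i = (if i = Suc 0 then e1 - (A \<union> B) else e2 - (A \<union> C))" for i :: nat
  define k where "k = r - card (A \<union> B)"
  have "A \<inter> B = {}" "A \<inter> C = {}" using disj B C by auto
  then have kC: "r - card (A \<union> C) = k" unfolding k_def using A fB BC by (simp add: card_Un_disjoint)
  have cU: "finite (U i)" "card (U i) = k" for i
    using edge[OF e1(1)] edge[OF e2(1)] e1(2) e2(2) kC A fB
    by (auto simp: U_def k_def card_Diff_subset)
  obtain g where g: "\<And>i. bij_betw (g i) {..<k} (U i)"
  proof -
    have "\<forall>i. \<exists>h. bij_betw h {..<k} (U i)"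
      using cU by (simp add: finite_same_card_bij)
    then show thesis using that by metis
  qed
  define f where "f = case_sum (\<lambda>x. x) (\<lambda>(i, j). g i j)"
  let ?P = "private_set r [E, A \<union> B, A \<union> C]"
  \<comment> \<open>\<open>E\<close> already has \<open>r\<close> vertices, so its extension adds
    none.\<close>
  have P0: "?P 0 = {}" using fE by (simp add: private_set_def)
  have P1: "?P (Suc 0) = Inr ` ({Suc 0} \<times> {..<k})" by (simp add: private_set_def k_def)
  have P2: "?P (Suc (Suc 0)) = Inr ` ({Suc (Suc 0)} \<times> {..<k})" by (simp add: private_set_def kC)
  have V: "verts (uniform_extension r (A \<union> E) [E, A \<union> B, A \<union> C])
      = Inl ` (A \<union> E) \<union> (Inr ` ({Suc 0} \<times> {..<k}) \<union> Inr ` ({Suc (Suc 0)} \<times> {..<k}))"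
    by (auto simp: uniform_extension_def lessThan_Suc P0 P1 P2)
  have edges: "edges (uniform_extension r (A \<union> E) [E, A \<union> B, A \<union> C])
      = {Inl ` E, Inl ` (A \<union> B) \<union> Inr ` ({Suc 0} \<times> {..<k}),
         Inl ` (A \<union> C) \<union> Inr ` ({Suc (Suc 0)} \<times> {..<k})}"
    (is "?l = _")
  proof -
    have "?l = (\<lambda>j. Inl ` ([E, A \<union> B, A \<union> C] ! j) \<union> ?P j) ` {..<3}"
      by (auto simp: uniform_extension_def)
    also have "{..<3} = {0, Suc 0, Suc (Suc 0)}" by auto
    finally show ?thesis by (simp only: image_insert image_empty P0 P1 P2) simp
  qed
  have fInl: "f ` Inl ` S = S" for S by (force simp: f_def)
  have fInr: "f ` Inr ` ({i} \<times> {..<k}) = U i" for i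
  proof -
    have "f ` Inr ` ({i} \<times> {..<k}) = g i ` {..<k}" by (auto simp: f_def image_image)
    then show ?thesis using g[of i] by (simp add: bij_betw_def)
  qed
  have inj_Un: "inj_on f (X \<union> Y)" if "inj_on f X" "inj_on f Y" "f ` X \<inter> f ` Y = {}" for X Y
    using that by (auto simp: inj_on_Un)
  have inr: "inj_on f (Inr ` ({i} \<times> {..<k}))" for i
    using bij_betw_imp_inj_on[OF g[of i]] by (auto simp: f_def inj_on_def)
  have inl: "inj_on f (Inl ` S)" for S by (auto simp: f_def inj_on_def)
  have dis: "U (Suc 0) \<inter> U (Suc (Suc 0)) = {}" "(A \<union> E) \<inter> U (Suc 0) = {}"
    "(A \<union> E) \<inter> U (Suc (Suc 0)) = {}"
    using e1 e2 by (auto simp: U_def)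
  have "inj_on f (Inl ` (A \<union> E) \<union> (Inr ` ({Suc 0} \<times> {..<k}) \<union> Inr ` ({Suc (Suc 0)} \<times> {..<k})))"
    by (intro inj_Un inr inl) (simp_all only: image_Un[of f] fInl fInr Int_Un_distrib dis Un_empty_left)
  moreover have "f ` (Inl ` (A \<union> E) \<union> (Inr ` ({Suc 0} \<times> {..<k}) \<union> Inr ` ({Suc (Suc 0)} \<times> {..<k}))) \<subseteq> verts H"
    unfolding image_Un fInl fInr using edge[OF e1(1)] edge[OF e2(1)] A fE by (auto simp: U_def)
  moreover have "A \<union> B \<union> U (Suc 0) = e1" "A \<union> C \<union> U (Suc (Suc 0)) = e2"
    using e1(2) e2(2) by (auto simp: U_def)
  ultimately show ?thesis
    unfolding contains_copy_def V edges
    by (intro exI[of _ f]) (use e1(1) e2(1) E in \<open>simp add: image_Un fInl fInr\<close>)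
qed

text \<open>Let two distinct members \<open>B\<close>, \<open>C\<close> meet in j vertices with j
  not in \<open>L\<close>. Then j < \<open>b\<close>, and 2\<open>b\<close> - j is the size of
  \<open>B \<union> C \<subseteq> E\<close>, hence at most \<open>r\<close>. So j lies in
  \<open>J_set r b L\<close>, and the configuration embedded by
  \<open>contains_uniform_extension\<close> is forbidden.\<close>

lemma L_intersecting_heavy:
  fixes H :: "nat hypergraph"
  assumes rH: "r_graph r H" and free: "family_free (T_family r a b L) H" and "a \<le> r"
    and A: "A \<in> nsets (verts H) a" and E: "E \<in> edges H" and disj: "A \<inter> E = {}"
  shows "L_intersecting L {B \<in> nsets E b. heavy (3 * r) (edges H) (A \<union> B)}"
  unfolding L_intersecting_def
proof (intro ballI impI, rule ccontr)
  fix B C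
  assume B: "B \<in> {B \<in> nsets E b. heavy (3 * r) (edges H) (A \<union> B)}"
    and C: "C \<in> {B \<in> nsets E b. heavy (3 * r) (edges H) (A \<union> B)}"
    and "B \<noteq> C" and notL: "card (B \<inter> C) \<notin> L"
  have E': "E \<subseteq> verts H" "finite E" "card E = r"
    using E rH nsetsD unfolding r_graph_def by blast+
  have A': "A \<subseteq> verts H" "finite A" "card A = a" using A nsetsD by blast+
  have BC: "B \<subseteq> E" "finite B" "card B = b" "C \<subseteq> E" "finite C" "card C = b"
    using B C by (auto simp: nsets_def)
  have "B \<inter> C \<subset> B" using BC \<open>B \<noteq> C\<close> by (metis card_subset_eq inf.cobounded1 inf.cobounded2 inf.orderE psubsetI)
  then have "card (B \<inter> C) < b" using BC psubset_card_mono by blast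
  moreover have "card (B \<union> C) \<le> r" using BC E' card_mono by (metis Un_subset_iff)
  then have "2 * b - card (B \<inter> C) \<le> r" using card_Un_Int[of B C] BC by simp
  ultimately have "card (B \<inter> C) \<in> J_set r b L" using notL by (simp add: J_set_def)
  moreover have "uniform_extension r (A \<union> E) [E, A \<union> B, A \<union> C] \<in> T_graphs r a b b (card (B \<inter> C))"
    unfolding T_graphs_def using E' A' BC disj by blast
  ultimately have "uniform_extension r (A \<union> E) [E, A \<union> B, A \<union> C] \<in> T_family r a b L"
    unfolding T_family_def by blast
  then have "\<not> contains_copy H (uniform_extension r (A \<union> E) [E, A \<union> B, A \<union> C])"
    using free unfolding family_free_def by blast
  then show False
    using contains_uniform_extension[OF rH A'(2,1) E disj BC(1,4)] BC A' B C \<open>a \<le> r\<close> by simp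
qed

section \<open>Counting triples of an \<open>a\<close>-set, a \<open>b\<close>-set and an
  edge\<close>

definition heavy_links :: "nat \<Rightarrow> 'v hypergraph \<Rightarrow> nat \<Rightarrow> 'v set \<Rightarrow> 'v set set" where
  "heavy_links q H a B = {A \<in> nsets (verts H - B) a. heavy q (edges H) (A \<union> B)}"

text \<open>The degrees of \<open>A \<union> B\<close>, summed over \<open>A\<close>, give
  \<open>r - b choose a\<close> times the degree of \<open>B\<close>. A heavy
  \<open>A \<union> B\<close> contributes at most \<open>n choose k\<close>, any other one a
  lower-order amount by \<open>degree_not_heavy\<close>. The factor \<open>n\<close> comes from that
  lemma, and \<open>fact k\<close> turns the binomial coefficient into a power without
  division.\<close>

lemma degree_le_card_heavy_links:
  assumes rH: "r_graph r H" and ab: "a + b \<le> r" and B: "B \<in> nsets (verts H) b"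
    and n: "n = card (verts H)" and k: "k = r - (a + b)"
  shows "n * (fact k * (r - b choose a)) * degree (edges H) B
    \<le> n ^ Suc k * card (heavy_links q H a B) + fact k * q * n ^ (a + k)"
proof -
  have fV: "finite (verts H)" and H: "edges H \<subseteq> nsets (verts H) r"
    using rH by (auto simp: r_graph_def)
  let ?N = "nsets (verts H - B) a" and ?h = "heavy_links q H a B"
  have fN: "finite ?N" using fV by (simp add: finite_imp_finite_nsets)
  have h: "?h \<subseteq> ?N" by (auto simp: heavy_links_def)
  have A: "A \<union> B \<subseteq> verts H" "finite (A \<union> B)" "card (A \<union> B) = a + b" if "A \<in> ?N" for A
  proof -
    have "A \<inter> B = {}" using nsetsD[OF that] by blast
    then show "A \<union> B \<subseteq> verts H" "finite (A \<union> B)" "card (A \<union> B) = a + b"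
      using nsetsD[OF that] nsetsD[OF B] by (auto simp: card_Un_disjoint)
  qed
  have cN: "card (?N - ?h) \<le> n ^ a"
  proof -
    have "card (?N - ?h) \<le> card (nsets (verts H) a)"
      using fV nsets_mono[of "verts H - B" "verts H" a]
      by (intro card_mono) (auto simp: finite_imp_finite_nsets)
    also have "\<dots> \<le> n ^ a" using binomial_le_power by (simp add: n)
    finally show ?thesis .
  qed
  have "n * (degree (edges H) B * (r - b choose a)) = (\<Sum>A\<in>?N. n * degree (edges H) (A \<union> B))"
    by (simp add: sum_degree_Un[OF fV H B, symmetric] sum_distrib_left)
  also have "\<dots> = (\<Sum>A\<in>?N - ?h. n * degree (edges H) (A \<union> B)) + (\<Sum>A\<in>?h. n * degree (edges H) (A \<union> B))"
    by (rule sum.subset_diff[OF h fN])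
  also have "\<dots> \<le> (\<Sum>A\<in>?N - ?h. q * n ^ k) + (\<Sum>A\<in>?h. n * (n choose k))"
  proof (intro add_mono sum_mono)
    fix A assume "A \<in> ?N - ?h"
    then show "n * degree (edges H) (A \<union> B) \<le> q * n ^ k"
      using degree_not_heavy[OF fV H, of "A \<union> B" q] A[of A] ab
      by (simp add: heavy_links_def n k)
  next
    fix A assume "A \<in> ?h"
    then show "n * degree (edges H) (A \<union> B) \<le> n * (n choose k)"
      using degree_le[OF fV H, of "A \<union> B"] A[of A] h by (auto simp: n k)
  qed
  also have "\<dots> = card (?N - ?h) * (q * n ^ k) + card ?h * (n * (n choose k))" by simp
  also have "\<dots> \<le> n ^ a * (q * n ^ k) + card ?h * (n * (n choose k))"
    using cN by (intro add_mono mult_mono) auto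
  finally have "fact k * (n * (degree (edges H) B * (r - b choose a)))
      \<le> fact k * (n ^ a * (q * n ^ k) + card ?h * (n * (n choose k)))"
    by (rule mult_left_mono) simp
  also have "\<dots> = fact k * q * n ^ (a + k) + card ?h * n * (fact k * (n choose k))"
    by (simp add: algebra_simps power_add)
  also have "\<dots> \<le> fact k * q * n ^ (a + k) + card ?h * n * n ^ k"
    by (intro add_mono mult_mono fact_mult_binomial_le_pow) auto
  finally show ?thesis by (simp add: algebra_simps)
qed

text \<open>The left side counts triples \<open>(A, B, E)\<close> with
  \<open>B \<subseteq> E\<close> and \<open>A\<close> a heavy link of \<open>B\<close>. For fixed
  \<open>E\<close>, each \<open>A\<close> disjoint from \<open>E\<close> admits at most
  \<open>Psi r b L\<close> sets \<open>B\<close>. The at most \<open>r * n ^ a\<close> sets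
  \<open>A\<close> meeting \<open>E\<close> get the trivial bound \<open>r choose b\<close>.\<close>

lemma sum_heavy_links_degree_le:
  fixes H :: "nat hypergraph"
  assumes rH: "r_graph r H" and free: "family_free (T_family r (Suc a) b L) H" and ar: "Suc a \<le> r"
    and n: "n = card (verts H)"
  shows "(\<Sum>B\<in>nsets (verts H) b. card (heavy_links (3 * r) H (Suc a) B) * degree (edges H) B)
    \<le> card (edges H) * ((n choose Suc a) * Psi r b L + r * n ^ a * (r choose b))"
proof -
  have fV: "finite (verts H)" and H: "edges H \<subseteq> nsets (verts H) r"
    using rH by (auto simp: r_graph_def)
  have fH: "finite (edges H)" using finite_edges[OF fV H] .
  let ?N = "nsets (verts H) (Suc a)" and ?b = "nsets (verts H) b"
  let ?P = "\<lambda>B p. fst p \<in> heavy_links (3 * r) H (Suc a) B \<and> B \<subseteq> snd p"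
  have fN: "finite ?N" using fV by (simp add: finite_imp_finite_nsets)
  have hN: "heavy_links (3 * r) H (Suc a) B \<subseteq> ?N" for B
    using nsets_mono[of "verts H - B" "verts H"] by (auto simp: heavy_links_def)
  have "(\<Sum>B\<in>?b. card (heavy_links (3 * r) H (Suc a) B) * degree (edges H) B)
      = (\<Sum>B\<in>?b. card {p \<in> ?N \<times> edges H. ?P B p})"
  proof (rule sum.cong[OF refl])
    fix B
    have "{p \<in> ?N \<times> edges H. ?P B p} = heavy_links (3 * r) H (Suc a) B \<times> {e \<in> edges H. B \<subseteq> e}"
      using hN by auto
    then show "card (heavy_links (3 * r) H (Suc a) B) * degree (edges H) B
        = card {p \<in> ?N \<times> edges H. ?P B p}"
      by (simp add: degree_def card_cartesian_product)
  qed
  also have "\<dots> = (\<Sum>p\<in>?N \<times> edges H. card {B \<in> ?b. ?P B p})"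
    using fV fN fH by (intro card_incidences) (auto simp: finite_imp_finite_nsets)
  also have "\<dots> = (\<Sum>A\<in>?N. \<Sum>E\<in>edges H. card {B \<in> ?b. ?P B (A, E)})"
    by (simp add: sum.cartesian_product case_prod_beta)
  also have "\<dots> = (\<Sum>E\<in>edges H. \<Sum>A\<in>?N. card {B \<in> ?b. ?P B (A, E)})"
    by (rule sum.swap)
  also have "\<dots> \<le> (\<Sum>E\<in>edges H. (n choose Suc a) * Psi r b L + r * n ^ a * (r choose b))"
  proof (rule sum_mono)
    fix E assume E: "E \<in> edges H"
    then have E': "E \<subseteq> verts H" "finite E" "card E = r" using H nsetsD by blast+
    have "(\<Sum>A\<in>?N. card {B \<in> ?b. ?P B (A, E)})
        \<le> (\<Sum>A\<in>?N. Psi r b L + (if A \<inter> E \<noteq> {} then r choose b else 0))"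
    proof (rule sum_mono)
      fix A assume A: "A \<in> ?N"
      show "card {B \<in> ?b. ?P B (A, E)} \<le> Psi r b L + (if A \<inter> E \<noteq> {} then r choose b else 0)"
      proof (cases "A \<inter> E = {}")
        case True
        let ?F = "{B \<in> nsets E b. heavy (3 * r) (edges H) (A \<union> B)}"
        have fE: "finite (nsets E b)" using E' by (simp add: finite_imp_finite_nsets)
        have "card {B \<in> ?b. ?P B (A, E)} \<le> card ?F"
          using finite_subset[OF _ fE, of ?F]
          by (intro card_mono) (auto simp: heavy_links_def nsets_def)
        also have "\<dots> \<le> Psi r b L"
          using E' by (intro card_L_intersecting_le_Psi[OF _ _ _ L_intersecting_heavy[OF rH free ar A E True]]) auto
        finally show ?thesis by simp
      next
        case False
        have "card {B \<in> ?b. ?P B (A, E)} \<le> card (nsets E b)"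
          using E' by (intro card_mono) (auto simp: nsets_def finite_subset)
        then show ?thesis using False E' by simp
      qed
    qed
    also have "\<dots> = (n choose Suc a) * Psi r b L + card {A\<in>?N. A \<inter> E \<noteq> {}} * (r choose b)"
      using fN by (simp add: sum.distrib sum.If_cases Int_def n)
    also have "\<dots> \<le> (n choose Suc a) * Psi r b L + r * n ^ a * (r choose b)"
      using card_nsets_meeting_le[OF fV E'(2), of a] E' n by (intro add_mono mult_mono) auto
    finally show "(\<Sum>A\<in>?N. card {B \<in> ?b. ?P B (A, E)})
        \<le> (n choose Suc a) * Psi r b L + r * n ^ a * (r choose b)" .
  qed
  finally show ?thesis by simp
qed

section \<open>The bound on the number of edges\<close>

lemma sum_squared_le_card_mult_sum_squares:
  fixes f :: "'a \<Rightarrow> nat"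
  shows "(\<Sum>i\<in>I. f i)\<^sup>2 \<le> card I * (\<Sum>i\<in>I. (f i)\<^sup>2)"
proof -
  have "real ((\<Sum>i\<in>I. f i)\<^sup>2) \<le> real (card I * (\<Sum>i\<in>I. (f i)\<^sup>2))"
    using sum_squared_le_sum_of_squares[of "\<lambda>i. real (f i)" I] by (simp add: mult.commute)
  then show ?thesis by (simp only: of_nat_le_iff)
qed

text \<open>The two binomial coefficients multiply to the multinomial coefficient r!/(a! b!
  k!).\<close>

lemma fact_mult_multinomial:
  assumes "a + b + k = r"
  shows "fact k * (r - b choose a) * fact a * fact b * (r choose b) = (fact r :: nat)"
proof -
  have "r - b = a + k" using assms by simp
  then have "fact a * fact k * (r - b choose a) = (fact (r - b) :: nat)"
    using binomial_fact_lemma[of a "r - b"] by simp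
  moreover have "fact b * fact (r - b) * (r choose b) = (fact r :: nat)"
    using binomial_fact_lemma[of b r] assms by simp
  moreover have "fact k * (r - b choose a) * fact a * fact b * (r choose b)
      = fact b * (fact a * fact k * (r - b choose a)) * (r choose b)"
    by (simp only: mult_ac)
  ultimately show ?thesis by simp
qed

text \<open>Divided by the factors in front of \<open>card (edges H)\<close>, this is the leading
  term \<open>Psi r b L / (r choose b)\<close> times n^r/r!, plus an error of order n^(r-1).\<close>

lemma card_edges_T_family_free_le:
  fixes H :: "nat hypergraph"
  assumes rH: "r_graph r H" and free: "family_free (T_family r (Suc a) b L) H"
    and abk: "Suc a + b + k = r" and n: "n = card (verts H)"
  shows "fact r * (r choose b) * card (edges H) * n
    \<le> n ^ Suc r * Psi r b L + fact (Suc a) * (r choose b) * (r + fact k * (3 * r)) * n ^ r"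
\<comment> \<open>The Cauchy--Schwarz step ends by cancelling the number of edges, hence the
  separate case.\<close>
proof (cases "card (edges H) = 0")
  case True
  then show ?thesis by simp
next
  case False
  have fV: "finite (verts H)" and H: "edges H \<subseteq> nsets (verts H) r"
    using rH by (auto simp: r_graph_def)
  let ?I = "nsets (verts H) b"
  define m where "m = card (edges H)"
  define C where "C = (r choose b)"
  define \<Psi> where "\<Psi> = Psi r b L"
  define M where "M = fact k * (r - b choose Suc a)"
  define c where "c = fact k * (3 * r)"
  define d where "d = degree (edges H)"
  define h where "h B = card (heavy_links (3 * r) H (Suc a) B)" for B
  define R where "R = n ^ Suc k * ((n choose Suc a) * \<Psi> + r * n ^ a * C) + c * n ^ (Suc a + k) * C"
  have k: "k = r - (Suc a + b)" using abk by simp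
  have sd: "(\<Sum>B\<in>?I. d B) = m * C" unfolding d_def m_def C_def by (rule sum_degree[OF fV H])
  have "n * M * (\<Sum>B\<in>?I. (d B)\<^sup>2) = (\<Sum>B\<in>?I. n * M * d B * d B)"
    by (simp add: sum_distrib_left power2_eq_square mult.assoc)
  \<comment> \<open>Only one factor \<open>d B\<close> of each square is estimated by heavy links;
    the other one supplies the edge of the triples.\<close>
  also have "\<dots> \<le> (\<Sum>B\<in>?I. (n ^ Suc k * h B + c * n ^ (Suc a + k)) * d B)"
    unfolding M_def c_def d_def h_def using abk
    by (intro sum_mono mult_right_mono degree_le_card_heavy_links[OF rH _ _ n k]) auto
  also have "\<dots> = n ^ Suc k * (\<Sum>B\<in>?I. h B * d B) + c * n ^ (Suc a + k) * (\<Sum>B\<in>?I. d B)"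
    by (simp add: sum_distrib_left sum.distrib algebra_simps)
  also have "\<dots> \<le> n ^ Suc k * (m * ((n choose Suc a) * \<Psi> + r * n ^ a * C)) + c * n ^ (Suc a + k) * (m * C)"
    using sum_heavy_links_degree_le[OF rH free _ n] abk unfolding sd
    by (intro add_mono mult_left_mono) (auto simp: m_def C_def \<Psi>_def h_def d_def)
  also have "\<dots> = m * R" by (simp add: R_def algebra_simps)
  finally have sq: "n * M * (\<Sum>B\<in>?I. (d B)\<^sup>2) \<le> m * R" .
  \<comment> \<open>Cauchy--Schwarz over the \<open>n choose b\<close> sets \<open>B\<close>, whose
    degrees sum to \<open>m * C\<close>.\<close>
  have "m * (n * M * C * (C * m)) = n * M * (m * C)\<^sup>2" by (simp add: power2_eq_square)
  also have "\<dots> \<le> n * M * ((n choose b) * (\<Sum>B\<in>?I. (d B)\<^sup>2))"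
    using sum_squared_le_card_mult_sum_squares[of d ?I] by (intro mult_left_mono) (auto simp: sd n)
  also have "\<dots> = (n choose b) * (n * M * (\<Sum>B\<in>?I. (d B)\<^sup>2))" by simp
  also have "\<dots> \<le> (n choose b) * (m * R)" using sq by (rule mult_left_mono) simp
  finally have "m * (n * M * C * (C * m)) \<le> m * ((n choose b) * R)" by (simp add: mult.left_commute)
  then have le: "n * M * C * (C * m) \<le> (n choose b) * R" using False by (simp add: m_def)
  have "fact (Suc a) * R = n ^ Suc k * ((fact (Suc a) * (n choose Suc a)) * \<Psi>)
      + fact (Suc a) * C * (r + c) * n ^ (Suc a + k)"
    unfolding R_def by (simp only: distrib_left distrib_right power_add power_Suc mult_ac add_ac)
  also have "\<dots> \<le> n ^ Suc k * (n ^ Suc a * \<Psi>) + fact (Suc a) * C * (r + c) * n ^ (Suc a + k)"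
    by (intro add_mono mult_left_mono mult_right_mono fact_mult_binomial_le_pow) auto
  finally have R: "fact (Suc a) * R
      \<le> n ^ Suc k * (n ^ Suc a * \<Psi>) + fact (Suc a) * C * (r + c) * n ^ (Suc a + k)" .
  \<comment> \<open>\<open>fact r\<close> is split so that its factors \<open>fact (Suc a)\<close>
    and \<open>fact b\<close> turn the binomial coefficients of \<open>n\<close> into powers, while
    the rest is \<open>M * C\<close>.\<close>
  have "fact r * C * m * n = fact (Suc a) * fact b * (n * M * C * (C * m))"
    unfolding fact_mult_multinomial[OF abk, symmetric] by (simp only: M_def C_def mult_ac)
  also have "\<dots> \<le> fact (Suc a) * fact b * ((n choose b) * R)"
    using le by (rule mult_left_mono) simp
  also have "\<dots> = (fact b * (n choose b)) * (fact (Suc a) * R)"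
    by (simp only: mult_ac)
  also have "\<dots> \<le> n ^ b * (n ^ Suc k * (n ^ Suc a * \<Psi>) + fact (Suc a) * C * (r + c) * n ^ (Suc a + k))"
    using R by (intro mult_mono fact_mult_binomial_le_pow) auto
  also have "\<dots> = n ^ (Suc a + b + Suc k) * \<Psi> + fact (Suc a) * C * (r + c) * n ^ (Suc a + b + k)"
    by (simp only: distrib_left power_add mult_ac)
  also have "\<dots> = n ^ Suc r * \<Psi> + fact (Suc a) * C * (r + c) * n ^ r"
    using abk by simp
  finally show ?thesis by (simp only: C_def \<Psi>_def c_def m_def)
qed

section \<open>Extremal numbers and existence of the density\<close>

lemma finite_free_edge_numbers:
  "finite {card (edges H) | H :: nat hypergraph.
     r_graph r H \<and> card (verts H) = n \<and> family_free \<F> H}"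
proof (rule finite_subset)
  show "{card (edges H) | H :: nat hypergraph.
     r_graph r H \<and> card (verts H) = n \<and> family_free \<F> H} \<subseteq> {..n choose r}"
  proof
    fix m assume "m \<in> {card (edges H) | H :: nat hypergraph.
      r_graph r H \<and> card (verts H) = n \<and> family_free \<F> H}"
    then obtain H :: "nat hypergraph" where
      H: "r_graph r H" "card (verts H) = n" "m = card (edges H)" by blast
    then have "card (edges H) \<le> card (nsets (verts H) r)"
      unfolding r_graph_def by (intro card_mono) (auto simp: finite_imp_finite_nsets)
    then show "m \<in> {..n choose r}" using H by simp
  qed
qed simp

lemma card_edges_le_ex_number:
  fixes H :: "nat hypergraph"
  assumes "r_graph r H" "card (verts H) = n" "family_free \<F> H"
  shows "card (edges H) \<le> ex_number r n \<F>"
  unfolding ex_number_def using assms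
  by (intro Max_ge finite_free_edge_numbers CollectI exI[of _ H] conjI refl)

text \<open>If every member of the family has an edge, the edgeless hypergraph is free, so the
  maximum is over a nonempty set.\<close>

lemma ex_number_attained:
  assumes "\<And>F. F \<in> \<F> \<Longrightarrow> edges F \<noteq> {}"
  obtains H :: "nat hypergraph" where "r_graph r H" "card (verts H) = n" "family_free \<F> H"
    "card (edges H) = ex_number r n \<F>"
proof -
  let ?S = "{card (edges H) | H :: nat hypergraph.
    r_graph r H \<and> card (verts H) = n \<and> family_free \<F> H}"
  have "r_graph r ({..<n}, {})" "card (verts ({..<n}, {})) = n" "family_free \<F> ({..<n}, {})"
    using assms by (auto simp: r_graph_def family_free_def contains_copy_def)
  then have "?S \<noteq> {}" by blast
  then have "ex_number r n \<F> \<in> ?S"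
    unfolding ex_number_def by (rule Max_in[OF finite_free_edge_numbers])
  then show thesis using that by auto
qed

text \<open>Delete each vertex of an extremal hypergraph in turn: every edge survives
  \<open>Suc n - r\<close> of the deletions, and each remainder is free on \<open>n\<close>
  vertices.\<close>

lemma ex_number_Suc_le:
  assumes \<F>: "\<And>F. F \<in> \<F> \<Longrightarrow> edges F \<noteq> {}"
  shows "(Suc n - r) * ex_number r (Suc n) \<F> \<le> Suc n * ex_number r n \<F>"
proof -
  obtain H :: "nat hypergraph" where rH: "r_graph r H" and n: "card (verts H) = Suc n"
    and free: "family_free \<F> H" and ex: "card (edges H) = ex_number r (Suc n) \<F>"
    using ex_number_attained[OF \<F>] by blast
  have fV: "finite (verts H)" and H: "edges H \<subseteq> nsets (verts H) r"
    using rH by (auto simp: r_graph_def)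
  have "(Suc n - r) * ex_number r (Suc n) \<F> = (\<Sum>e\<in>edges H. Suc n - r)" by (simp add: ex)
  also have "\<dots> = (\<Sum>e\<in>edges H. card {v \<in> verts H. v \<notin> e})"
  proof (rule sum.cong[OF refl])
    fix e assume "e \<in> edges H"
    then have e: "e \<subseteq> verts H" "finite e" "card e = r" using H nsetsD by blast+
    have "{v \<in> verts H. v \<notin> e} = verts H - e" by blast
    then show "Suc n - r = card {v \<in> verts H. v \<notin> e}" using e n by (simp add: card_Diff_subset)
  qed
  also have "\<dots> = (\<Sum>v\<in>verts H. card {e \<in> edges H. v \<notin> e})"
    by (rule card_incidences[OF finite_edges[OF fV H] fV])
  also have "\<dots> \<le> (\<Sum>v\<in>verts H. ex_number r n \<F>)"
  proof (rule sum_mono)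
    fix v assume v: "v \<in> verts H"
    let ?H = "(verts H - {v}, {e \<in> edges H. v \<notin> e})"
    have "r_graph r ?H" using fV H by (auto simp: r_graph_def nsets_def)
    moreover have "card (verts ?H) = n" using v n fV by simp
    moreover have "family_free \<F> ?H"
      unfolding family_free_def
    proof (intro ballI notI)
      fix F assume F: "F \<in> \<F>" and "contains_copy ?H F"
      then have "contains_copy H F" unfolding contains_copy_def by fastforce
      then show False using free F by (simp add: family_free_def)
    qed
    ultimately have "card (edges ?H) \<le> ex_number r n \<F>" by (rule card_edges_le_ex_number)
    then show "card {e \<in> edges H. v \<notin> e} \<le> ex_number r n \<F>" by simp
  qed
  also have "\<dots> = Suc n * ex_number r n \<F>" by (simp add: n)
  finally show ?thesis .
qed

text \<open>Averaging over the induced subgraphs on one vertex less shows that the edge densities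
  of extremal hypergraphs decrease, so that the limit defining the density exists.\<close>

lemma tendsto_turan_density:
  fixes \<F> :: "'v hypergraph set"
  assumes \<F>: "\<And>F. F \<in> \<F> \<Longrightarrow> edges F \<noteq> {}"
  shows "(\<lambda>n. real (ex_number r n \<F>) / real (n choose r)) \<longlonglongrightarrow> turan_density r \<F>"
proof -
  let ?f = "\<lambda>n. real (ex_number r n \<F>) / real (n choose r)"
  \<comment> \<open>The shift by \<open>r\<close> keeps the binomial coefficients positive: below
    \<open>r\<close> the quotient is 0 by division by zero, which would break monotonicity.\<close>
  have "?f (Suc n + r) \<le> ?f (n + r)" for n
  proof -
    define s t x y p q where "s = real (Suc n)" and "t = real (Suc (n + r))"
      and "x = real (ex_number r (Suc (n + r)) \<F>)" and "y = real (ex_number r (n + r) \<F>)"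
      and "p = real (Suc (n + r) choose r)" and "q = real (n + r choose r)"
    have "Suc n * ex_number r (Suc (n + r)) \<F> \<le> Suc (n + r) * ex_number r (n + r) \<F>"
      using ex_number_Suc_le[OF \<F>, where n = "n + r" and r = r] by simp
    then have 1: "s * x \<le> t * y" unfolding s_def t_def x_def y_def by (metis of_nat_le_iff of_nat_mult)
    have "Suc n * (Suc (n + r) choose r) = Suc (n + r) * (n + r choose r)"
      using binomial_absorb_comp[of "Suc (n + r)" r] by simp
    then have 2: "s * p = t * q" unfolding s_def t_def p_def q_def by (metis of_nat_mult)
    have pos: "s > 0" "p > 0" "q > 0" by (simp_all add: s_def p_def q_def)
    have "s * (x * q) = (s * x) * q" by simp
    also have "\<dots> \<le> (t * y) * q" using 1 pos by (intro mult_right_mono) auto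
    also have "\<dots> = s * (y * p)" using 2 by (metis mult.commute mult.left_commute)
    finally have "x * q \<le> y * p" using pos by simp
    then have "x / p \<le> y / q" using pos by (simp add: field_simps)
    then show ?thesis by (simp add: x_def y_def p_def q_def)
  qed
  then have "decseq (\<lambda>n. ?f (n + r))" by (intro decseq_SucI) simp
  then obtain l where "(\<lambda>n. ?f (n + r)) \<longlonglongrightarrow> l"
    using decseq_convergent[of "\<lambda>n. ?f (n + r)" 0] by auto
  then have "?f \<longlonglongrightarrow> l" by (rule LIMSEQ_offset)
  then show ?thesis unfolding turan_density_def by (simp add: limI)
qed

section \<open>Passage to the limit\<close>

text \<open>The quotient is a product of \<open>r\<close> factors n/(n - i), each tending to 1. For
  n < \<open>r\<close> the identity persists, as both sides are 0 by division by zero.\<close>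

lemma tendsto_power_over_fact_binomial:
  "(\<lambda>n. real n ^ r / (fact r * real (n choose r))) \<longlonglongrightarrow> 1"
proof -
  have "(\<lambda>n. \<Prod>i = 0..<r. real n / (real n - real i)) \<longlonglongrightarrow> (\<Prod>i = 0..<r. 1)"
    by (intro tendsto_prod) real_asymp
  moreover have "(\<Prod>i = 0..<r. real n / (real n - real i)) = real n ^ r / (fact r * real (n choose r))"
    for n
    using gbinomial_mult_fact[of r "real n"]
    by (simp add: prod_dividef binomial_gbinomial)
  ultimately show ?thesis by simp
qed

lemma edges_T_family_nonempty: "F \<in> T_family r a b L \<Longrightarrow> edges F \<noteq> {}"
  by (auto simp: T_family_def T_graphs_def uniform_extension_def)

theorem theorem1p2:
  fixes r a b :: nat and L :: "nat set"
  assumes "1 \<le> b" and "b < r" and "1 \<le> a" and "a + b \<le> r"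
    and "L \<subseteq> {0..b}"
  shows "turan_density r (T_family r a b L) \<le> real (Psi r b L) / real (r choose b)"
proof -
  let ?\<F> = "T_family r a b L"
  obtain a' k where a: "a = Suc a'" and k: "Suc a' + b + k = r"
    using assms(3,4) by (metis Suc_diff_1 le_add_diff_inverse less_eq_Suc_le One_nat_def)
  define C \<Psi> c where "C = real (r choose b)" and "\<Psi> = real (Psi r b L)"
    and "c = real (fact (Suc a') * (r choose b) * (r + fact k * (3 * r)))"
  let ?u = "\<lambda>n. real n ^ r / (fact r * real (n choose r))"
  have C: "C > 0" using assms(2) by (simp add: C_def)
  \<comment> \<open>This is the edge bound divided by \<open>fact r * C * n * (n choose r)\<close>;
    the lower-order term becomes \<open>c / C / real n\<close>, and \<open>?u\<close> tends to
    1.\<close>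
  have "real (ex_number r n ?\<F>) / real (n choose r) \<le> (\<Psi> / C + c / C / real n) * ?u n"
    if n: "n > r" for n
  proof -
    obtain H :: "nat hypergraph" where H: "r_graph r H" "card (verts H) = n"
      "family_free ?\<F> H" "card (edges H) = ex_number r n ?\<F>"
      by (rule ex_number_attained[where r = r and n = n and \<F> = ?\<F>])
        (auto dest: edges_T_family_nonempty)
    define m N where "m = real (ex_number r n ?\<F>)" and "N = real n"
    have "real (fact r * (r choose b) * ex_number r n ?\<F> * n)
        \<le> real (n ^ Suc r * Psi r b L + fact (Suc a') * (r choose b) * (r + fact k * (3 * r)) * n ^ r)"
      using card_edges_T_family_free_le[OF H(1) H(3)[unfolded a] k H(2)[symmetric]]
      unfolding H(4) a by (rule of_nat_mono)
    then have "fact r * C * m * N \<le> N ^ Suc r * \<Psi> + c * N ^ r"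
      by (simp only: m_def N_def C_def \<Psi>_def c_def of_nat_add of_nat_mult of_nat_power of_nat_fact)
    moreover have pos: "N > 0" "real (n choose r) > 0" using n by (auto simp: N_def)
    ultimately have "m \<le> (\<Psi> / C + c / C / N) * (N ^ r / fact r)"
      using C by (simp add: field_simps)
    then have "m / real (n choose r) \<le> (\<Psi> / C + c / C / N) * (N ^ r / fact r) / real (n choose r)"
      using pos by (intro divide_right_mono) auto
    then show ?thesis by (simp add: m_def N_def)
  qed
  then have "eventually (\<lambda>n. real (ex_number r n ?\<F>) / real (n choose r)
      \<le> (\<Psi> / C + c / C / real n) * ?u n) sequentially"
    using eventually_gt_at_top[of r] by (rule eventually_mono[rotated])
  moreover have "(\<lambda>n. (\<Psi> / C + c / C / real n) * ?u n) \<longlonglongrightarrow> (\<Psi> / C + 0) * 1"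
    by (intro tendsto_intros tendsto_power_over_fact_binomial lim_const_over_n)
  moreover have "(\<lambda>n. real (ex_number r n ?\<F>) / real (n choose r)) \<longlonglongrightarrow> turan_density r ?\<F>"
    by (rule tendsto_turan_density[OF edges_T_family_nonempty])
  ultimately have "turan_density r ?\<F> \<le> (\<Psi> / C + 0) * 1"
    by (intro tendsto_le[OF trivial_limit_sequentially])
  then show ?thesis by (simp add: C_def \<Psi>_def)
qed

end
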